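(* Let $M\subseteq\mathbb{R}^d$ be a free $\mathbb{Z}$-module of rank $k$ spanning $\mathbb{R}^d$, and let $R\in\mathrm{O}(d,\mathbb{R})$. Then every $\alpha\in\mathrm{Scal}_M(R)$ is an algebraic integer, and its degree is at most $k(k-1)$.
   Context: A free $\mathbb{Z}$-module of rank $k$ in $\mathbb{R}^d$ is $M=\langle t_1,\dots,t_k\rangle_{\mathbb{Z}}$ with $t_1,\dots,t_k\in\mathbb{R}^d$ rationally independent and spanning $\mathbb{R}^d$. For $R\in\mathrm{O}(d,\mathbb{R})$, $\mathrm{Scal}_M(R):=\{\alpha\in\mathbb{R}\mid \alpha RM\subseteq M\}$.
   Formalization: The degree bound k(k-1) is claimed only for k ≥ 2 (for k = 1 it would be 0, which is false: M = Z, R = 1, α = 1 has degree 1; integrality is still claimed), and d ≥ 1 is assumed (for d = 0, Scal is all of R). *)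

theory Defs
  imports "HOL-Analysis.Analysis" "HOL-Computational_Algebra.Polynomial"
begin

definition rationally_independent :: "nat \<Rightarrow> (nat \<Rightarrow> 'a::real_vector) \<Rightarrow> bool" where
  "rationally_independent k t \<longleftrightarrow>
     (\<forall>q :: nat \<Rightarrow> rat. (\<Sum>i<k. (of_rat (q i) :: real) *\<^sub>R t i) = 0 \<longrightarrow> (\<forall>i<k. q i = 0))"

definition int_hull :: "nat \<Rightarrow> (nat \<Rightarrow> 'a::real_vector) \<Rightarrow> 'a set" where
  "int_hull k t = range (\<lambda>c :: nat \<Rightarrow> int. \<Sum>i<k. (of_int (c i) :: real) *\<^sub>R t i)"

text \<open>The generators are \<open>t 0, \<dots>, t (k - 1)\<close>. The rank \<open>k\<close> may exceed the dimension of the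
  ambient space, so the module need not be discrete.\<close>
definition free_int_module :: "nat \<Rightarrow> 'a::real_vector set \<Rightarrow> bool" where
  "free_int_module k M \<longleftrightarrow>
     (\<exists>t. rationally_independent k t \<and> span (t ` {..<k}) = UNIV \<and> M = int_hull k t)"

definition Scal :: "(real ^ 'd) set \<Rightarrow> real ^ 'd ^ 'd \<Rightarrow> real set" where
  "Scal M R = {\<alpha>. (\<lambda>x. \<alpha> *\<^sub>R (R *v x)) ` M \<subseteq> M}"

text \<open>The degree over the rationals, i.e. the degree of the minimal polynomial. The value is
  meaningful only for algebraic arguments.\<close>
definition algebraic_degree :: "real \<Rightarrow> nat" where
  "algebraic_degree \<alpha> =
     (LEAST n. \<exists>p :: rat poly. p \<noteq> 0 \<and> poly (map_poly of_rat p) \<alpha> = 0 \<and> degree p = n)"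

end

theory Submission
  imports Defs "Jordan_Normal_Form.Char_Poly"
begin

text \<open>The adjoint of \<open>\<alpha> R\<close> is the restriction of an integer \<open>k \<times> k\<close> matrix \<open>A\<close> to the
  invariant subspace of all vectors \<open>(x \<bullet> t j)\<^sub>j\<close>. An eigenvector \<open>x\<close> of the symmetric matrix
  \<open>R + R\<^sup>T\<close> spans together with \<open>y = R\<^sup>T x\<close> a subspace invariant under \<open>R\<^sup>T\<close>. Since
  \<open>R\<^sup>T y = c y - x\<close>, the bivector \<open>x \<and> y\<close> is fixed by \<open>R\<^sup>T\<close>. If it is nonzero, \<open>\<alpha>\<^sup>2\<close> is an
  eigenvalue of the exterior square of \<open>A\<close>, an integer matrix of size \<open>k (k - 1) / 2\<close>.
  Otherwise \<open>y = x\<close> or \<open>y = - x\<close>, and \<open>\<alpha>\<close> is an eigenvalue of \<open>A\<close> or \<open>- A\<close>.\<close>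

text \<open>After a relabelling of the indices, \<open>X\<close> is an eigenvector of an integer
  matrix, whose characteristic polynomial is monic of degree \<open>card I\<close>. The index set is
  arbitrary so that pairs may serve as indices.\<close>

lemma root_of_monic_int_poly:
  fixes X :: "'i \<Rightarrow> real" and B :: "'i \<Rightarrow> 'i \<Rightarrow> int" and \<mu> :: real
  assumes "finite I" and "i0 \<in> I" "X i0 \<noteq> 0"
    and eigen: "\<And>i. i \<in> I \<Longrightarrow> \<mu> * X i = (\<Sum>j\<in>I. of_int (B i j) * X j)"
  obtains p :: "int poly"
  where "lead_coeff p = 1" "degree p = card I" "poly (map_poly of_int p) \<mu> = 0"
proof -
  define n where "n = card I"
  obtain e where e: "bij_betw e {0..<n} I"
    using ex_bij_betw_nat_finite[OF \<open>finite I\<close>] by (auto simp: n_def)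
  define A where "A = mat n n (\<lambda>(r, s). B (e r) (e s))"
  define v where "v = vec n (\<lambda>r. X (e r))"
  have A: "A \<in> carrier_mat n n" by (simp add: A_def)
  obtain r0 where r0: "r0 < n" "e r0 = i0"
    using e \<open>i0 \<in> I\<close> by (metis atLeastLessThan_iff bij_betw_iff_bijections)
  have "eigenvector (map_mat real_of_int A) v \<mu>"
    unfolding eigenvector_def
  proof (intro conjI)
    show "v \<noteq> 0\<^sub>v (dim_row (map_mat real_of_int A))"
    proof
      assume "v = 0\<^sub>v (dim_row (map_mat real_of_int A))"
      then have "vec_index v r0 = vec_index (0\<^sub>v n) r0" by (simp add: A_def)
      then show False using r0 \<open>X i0 \<noteq> 0\<close> by (simp add: v_def)
    qed
    show "map_mat real_of_int A *\<^sub>v v = \<mu> \<cdot>\<^sub>v v"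
    proof (rule eq_vecI)
      fix r assume "r < dim_vec (\<mu> \<cdot>\<^sub>v v)"
      then have r: "r < n" by (simp add: v_def)
      have "vec_index (map_mat real_of_int A *\<^sub>v v) r
          = (\<Sum>s\<in>{0..<n}. of_int (B (e r) (e s)) * X (e s))"
        using r by (simp add: A_def v_def scalar_prod_def)
      also have "\<dots> = (\<Sum>j\<in>I. of_int (B (e r) j) * X j)"
        by (rule sum.reindex_bij_betw[OF e])
      also have "\<dots> = \<mu> * X (e r)"
        using eigen[of "e r"] r e by (auto simp: bij_betw_def)
      finally show "vec_index (map_mat real_of_int A *\<^sub>v v) r = vec_index (\<mu> \<cdot>\<^sub>v v) r"
        using r by (simp add: v_def)
    qed (simp add: A_def v_def)
  qed (simp add: A_def v_def)
  then have "poly (char_poly (map_mat real_of_int A)) \<mu> = 0"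
    using eigenvalue_root_char_poly[of "map_mat real_of_int A" n \<mu>] A
    by (auto simp: eigenvalue_def)
  then have "poly (map_poly of_int (char_poly A)) \<mu> = 0"
    using of_int_hom.char_poly_hom[OF A, where 'a = real] by simp
  with degree_monic_char_poly[OF A] that show thesis
    by (metis n_def)
qed

text \<open>A maximiser \<open>x\<close> of the Rayleigh quotient on the compact unit sphere is an
  eigenvector, since otherwise moving it along the residual \<open>z\<close> gives a
  contradiction.\<close>

lemma symmetric_has_eigenvector:
  fixes f :: "'a::euclidean_space \<Rightarrow> 'a"
  assumes "linear f" and sym: "\<And>x y. f x \<bullet> y = x \<bullet> f y"
  obtains x c where "x \<noteq> 0" "f x = c *\<^sub>R x"
proof -
  interpret linear f by fact
  have cont: "continuous_on (sphere 0 1) (\<lambda>x. x \<bullet> f x)"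
    by (intro continuous_intros linear_continuous_on linear_conv_bounded_linear[THEN iffD1] assms)
  obtain b :: 'a where "b \<in> Basis" using nonempty_Basis by blast
  then have "sphere (0::'a) 1 \<noteq> {}" by auto
  then obtain x where x: "norm x = 1" and max: "\<And>y. norm y = 1 \<Longrightarrow> y \<bullet> f y \<le> x \<bullet> f x"
    using continuous_attains_sup[OF compact_sphere _ cont] by auto
  define c where "c = x \<bullet> f x"
  \<comment> \<open>By homogeneity, maximality on the sphere says that the quadratic form
    \<open>g\<close> is nonnegative everywhere; it vanishes at \<open>x\<close>.\<close>
  define g where "g y = c * (y \<bullet> y) - y \<bullet> f y" for y
  have g_nonneg: "g y \<ge> 0" for y
  proof (cases "y = 0")
    case False
    have "(y /\<^sub>R norm y) \<bullet> f (y /\<^sub>R norm y) \<le> c"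
      using max[of "y /\<^sub>R norm y"] False by (simp add: c_def)
    then show ?thesis
      using False by (simp add: g_def scale divide_simps power2_eq_square dot_square_norm)
  qed (simp add: g_def)
  define z where "z = c *\<^sub>R x - f x"
  define N where "N = z \<bullet> z"
  have expand: "g (x + s *\<^sub>R z) = 2 * s * N + s\<^sup>2 * g z" for s
  proof -
    have "x \<bullet> x = 1" using x by (simp add: dot_square_norm)
    have "g (x + s *\<^sub>R z) = g x + 2 * s * (c * (x \<bullet> z) - f x \<bullet> z) + s\<^sup>2 * g z"
      using sym[of x z]
      by (simp add: g_def add scale inner_simps inner_commute power2_eq_square algebra_simps)
    also have "g x = 0" using \<open>x \<bullet> x = 1\<close> by (simp add: g_def c_def)
    also have "c * (x \<bullet> z) - f x \<bullet> z = N"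
      by (simp add: N_def z_def inner_diff_left)
    finally show ?thesis by simp
  qed
  have "N = 0"
  proof (rule ccontr)
    assume "N \<noteq> 0"
    then have N: "N > 0" by (simp add: N_def)
    \<comment> \<open>The summand 1 keeps \<open>G\<close> positive even if \<open>g z = 0\<close>.
      At \<open>s = - N / G\<close> the linear term of \<open>expand\<close> outweighs the quadratic
      one.\<close>
    define G where "G = g z + 1"
    have G: "G > 0" "g z < 2 * G" using g_nonneg[of z] by (auto simp: G_def)
    have "0 \<le> 2 * (- N / G) * N + (- N / G)\<^sup>2 * g z"
      using g_nonneg expand by metis
    also have "\<dots> = (N / G)\<^sup>2 * (g z - 2 * G)"
      using G by (simp add: power2_eq_square field_simps)
    also have "\<dots> < 0" using N G by (intro mult_pos_neg) auto
    finally show False by simp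
  qed
  then have "f x = c *\<^sub>R x" by (simp add: N_def z_def)
  with x show thesis by (intro that[of x c]) auto
qed

text \<open>The left side is the determinant of the product of the matrix with rows
  \<open>a\<close>, \<open>b\<close> and the matrix with columns \<open>v\<close>, \<open>w\<close>.
  In the induction the new outer summand collects the minors that use the index
  \<open>k\<close>.\<close>

lemma Cauchy_Binet_two_rows:
  fixes a b v w :: "nat \<Rightarrow> 'a::comm_ring"
  shows "(\<Sum>i<k. a i * v i) * (\<Sum>i<k. b i * w i) - (\<Sum>i<k. b i * v i) * (\<Sum>i<k. a i * w i)
    = (\<Sum>j<k. \<Sum>i<j. (a j * b i - a i * b j) * (v j * w i - v i * w j))"
proof (induction k)
  case (Suc k)
  have "(\<Sum>i<k. (a k * b i - a i * b k) * (v k * w i - v i * w k))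
     = a k * v k * (\<Sum>i<k. b i * w i) - a k * w k * (\<Sum>i<k. b i * v i)
       - b k * v k * (\<Sum>i<k. a i * w i) + b k * w k * (\<Sum>i<k. a i * v i)"
    by (simp add: sum_distrib_left sum_subtractf[symmetric] sum.distrib[symmetric] algebra_simps)
  then show ?case
    by (simp only: sum.lessThan_Suc Suc[symmetric]) (simp add: algebra_simps)
qed simp

lemma card_ordered_pairs: "2 * card (SIGMA j:{..<k::nat}. {..<j}) = k * (k - 1)"
proof -
  have "2 * (\<Sum>j<k. j) = k * (k - 1)"
    by (induction k) (auto simp: algebra_simps)
  then show ?thesis by simp
qed

lemma algebraic_int_and_degree_le:
  fixes \<alpha> :: real and p :: "int poly"
  assumes "lead_coeff p = 1" "poly (map_poly of_int p) \<alpha> = 0"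
  shows "algebraic_int \<alpha>" "algebraic_degree \<alpha> \<le> degree p"
proof -
  show "algebraic_int \<alpha>"
    using assms algebraic_int_altdef_ipoly by blast
  let ?q = "map_poly of_int p :: rat poly"
  have "map_poly of_rat ?q = (map_poly of_int p :: real poly)"
    by (subst map_poly_map_poly) (auto simp: o_def)
  moreover have "degree ?q = degree p" by simp
  moreover have "?q \<noteq> 0" using assms(1) by auto
  ultimately show "algebraic_degree \<alpha> \<le> degree p"
    unfolding algebraic_degree_def using assms(2) by (intro Least_le exI[of _ ?q]) auto
qed

theorem theorem10:
  fixes M :: "(real ^ 'd) set" and R :: "real ^ 'd ^ 'd" and k :: nat and \<alpha> :: real
  assumes "free_int_module k M"
    and "orthogonal_matrix R"
    and "\<alpha> \<in> Scal M R"
  shows "algebraic_int \<alpha> \<and> (k \<ge> 2 \<longrightarrow> algebraic_degree \<alpha> \<le> k * (k - 1))"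
proof -
  obtain t where span: "span (t ` {..<k}) = UNIV" and M: "M = int_hull k t"
    using assms(1) by (auto simp: free_int_module_def)
  define T where "T x = Finite_Cartesian_Product.transpose R *v x" for x
  have adj: "T x \<bullet> y = x \<bullet> (R *v y)" for x y
    by (simp add: T_def dot_lmul_matrix flip: vector_transpose_matrix)
  have TR: "T (R *v x) = x" and RT: "R *v T x = x" for x
    using assms(2) unfolding T_def matrix_vector_mul_assoc
    by (simp_all add: orthogonal_matrix_def)
  have norm_T: "norm (T x) = norm x" for x
    by (simp add: norm_eq adj RT)

  have "t j \<in> M" if "j < k" for j
  proof -
    have "t j = (\<Sum>i<k. real_of_int (if i = j then 1 else 0) *\<^sub>R t i)"
      using that by (simp add: if_distrib[of real_of_int] if_distrib[of "\<lambda>r. r *\<^sub>R _"] cong: if_cong)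
    then show ?thesis unfolding M int_hull_def
      by (rule image_eqI[where x = "\<lambda>i. if i = j then 1 else 0"]) simp
  qed
  then have "\<exists>a. \<alpha> *\<^sub>R (R *v t j) = (\<Sum>i<k. real_of_int (a i) *\<^sub>R t i)" if "j < k" for j
    using assms(3) that by (fastforce simp: Scal_def M int_hull_def)
  then obtain A where A: "\<And>j. j < k \<Longrightarrow> \<alpha> *\<^sub>R (R *v t j) = (\<Sum>i<k. real_of_int (A j i) *\<^sub>R t i)"
    by metis
  \<comment> \<open>Pairing with \<open>x\<close> moves \<open>R\<close> to its adjoint:
    \<open>A\<close> maps the coordinates \<open>x \<bullet> t j\<close> to \<alpha> times those of
    \<open>T x\<close>.\<close>
  have A_inner: "\<alpha> * (T x \<bullet> t j) = (\<Sum>i<k. of_int (A j i) * (x \<bullet> t i))" if "j < k" for x j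
    using arg_cong[OF A[OF that], of "\<lambda>y. x \<bullet> y"] by (simp add: adj inner_sum_right)

  have separating: "x = 0" if "\<And>j. j < k \<Longrightarrow> x \<bullet> t j = 0" for x
    using orthogonal_to_span[of x "t ` {..<k}" x] that span by (auto simp: real_inner_class.orthogonal_def)

  have "linear T"
    unfolding T_def[abs_def] by (rule matrix_vector_mul_linear)
  then have "linear (\<lambda>x. T x + R *v x)"
    by (intro linear_compose_add matrix_vector_mul_linear)
  moreover have "(T x + R *v x) \<bullet> y = x \<bullet> (T y + R *v y)" for x y
    by (simp add: inner_simps adj) (metis adj inner_commute)
  ultimately obtain x c where x: "x \<noteq> 0" "T x + R *v x = c *\<^sub>R x"
    using symmetric_has_eigenvector by blast
  define y where "y = T x"
  \<comment> \<open>Apply \<open>T\<close>, the inverse of \<open>R\<close>, to the eigenvector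
    equation for \<open>x\<close>.\<close>
  have Ty: "T y = c *\<^sub>R y - x"
  proof -
    have "T (T x + R *v x) = T y + x"
      by (simp add: linear_add[OF \<open>linear T\<close>] y_def TR)
    moreover have "T (c *\<^sub>R x) = c *\<^sub>R y"
      by (simp add: linear_scale[OF \<open>linear T\<close>] y_def)
    ultimately show ?thesis using x(2) by (simp add: algebra_simps)
  qed
  define v where "v j = x \<bullet> t j" for j
  define w where "w j = y \<bullet> t j" for j
  have Av: "(\<Sum>i<k. of_int (A j i) * v i) = \<alpha> * w j" if "j < k" for j
    using A_inner[OF that, of x] by (simp add: v_def w_def y_def)
  have Aw: "(\<Sum>i<k. of_int (A j i) * w i) = \<alpha> * (c * w j - v j)" if "j < k" for j
    using A_inner[OF that, of y] by (simp add: v_def w_def Ty inner_simps)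
  obtain j0 where j0: "j0 < k" "v j0 \<noteq> 0"
    using separating[of x] x(1) by (auto simp: v_def)

  define P where "P = (SIGMA j:{..<k}. {..<j})"
  \<comment> \<open>These are the Pluecker coordinates of the bivector of \<open>x\<close> and
    \<open>y\<close>, one for each pair in \<open>P\<close>.\<close>
  define X where "X = (\<lambda>(j, i). v j * w i - v i * w j)"
  show ?thesis
  proof (cases "\<exists>q\<in>P. X q \<noteq> 0")
    case True
    \<comment> \<open>The second compound matrix of \<open>A\<close>, that is, its exterior
      square.\<close>
    define B where "B = (\<lambda>(j, i) (m, l). A j m * A i l - A j l * A i m)"
    have "\<alpha>\<^sup>2 * X q = (\<Sum>r\<in>P. of_int (B q r) * X r)" if "q \<in> P" for q
    proof -
      obtain j i where q: "q = (j, i)" "j < k" "i < k"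
        using \<open>q \<in> P\<close> by (auto simp: P_def)
      have "(\<Sum>r\<in>P. of_int (B q r) * X r)
          = (\<Sum>m<k. \<Sum>l<m. (of_int (A j m) * of_int (A i l) - of_int (A j l) * of_int (A i m))
              * (v m * w l - v l * w m))"
        unfolding P_def by (subst sum.Sigma) (auto simp: B_def X_def q(1) intro!: sum.cong)
      \<comment> \<open>By \<open>Av\<close> and \<open>Aw\<close> the determinant is that of the
        pairs \<open>w\<close> and \<open>c * w - v\<close>, up to the square of \<alpha>; the terms
        with \<open>c\<close> cancel.\<close>
      also have "\<dots> = \<alpha>\<^sup>2 * X q"
        using q by (simp only: Cauchy_Binet_two_rows[symmetric] Av Aw)
          (simp add: X_def power2_eq_square algebra_simps)
      finally show ?thesis ..
    qed
    moreover have "finite P" by (simp add: P_def)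
    ultimately obtain p :: "int poly" where p: "lead_coeff p = 1" "degree p = card P"
        "poly (map_poly of_int p) (\<alpha>\<^sup>2) = 0"
      using True root_of_monic_int_poly[of P _ X "\<alpha>\<^sup>2" B] by metis
    \<comment> \<open>Substituting the square of the variable turns a polynomial for the square of
      \<alpha> into one for \<alpha>; it stays monic and its degree doubles.\<close>
    define p2 where "p2 = pcompose p [:0, 0, 1:]"
    have "degree p2 = k * (k - 1)"
      using p(2) card_ordered_pairs[of k] by (simp add: p2_def degree_pcompose P_def)
    moreover have "lead_coeff p2 = 1"
      unfolding p2_def by (subst lead_coeff_comp) (simp_all add: p(1))
    moreover have "poly (map_poly of_int p2) \<alpha> = 0"
      using p(3) by (simp add: p2_def of_int_hom.map_poly_pcompose poly_pcompose power2_eq_square)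
    ultimately show ?thesis using algebraic_int_and_degree_le[of p2 \<alpha>] by simp
  next
    case False
    then have "v j * w i = v i * w j" if "i < j" "j < k" for i j
      using that by (fastforce simp: P_def X_def)
    then have minor0: "v j * w i = v i * w j" if "j < k" "i < k" for i j
      using that by (metis linorder_neqE_nat)
    \<comment> \<open>With all minors zero, \<open>w\<close> is proportional to \<open>v\<close>;
      the factor is read off at an index where \<open>v\<close> is nonzero.\<close>
    define \<mu> where "\<mu> = w j0 / v j0"
    have "y - \<mu> *\<^sub>R x = 0"
      using minor0[OF j0(1)] j0
      by (intro separating) (simp add: inner_simps \<mu>_def v_def w_def field_simps)
    then have y: "y = \<mu> *\<^sub>R x" by simp
    then have "\<bar>\<mu>\<bar> = 1" using norm_T[of x] x(1) by (simp add: y_def)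
    then obtain s :: int where s: "\<mu> = of_int s" "s * s = 1"
      by (metis abs_1 abs_eq_iff mult_1 mult_minus1 minus_minus of_int_1 of_int_minus)
    \<comment> \<open>Since \<open>T\<close> is an isometry, the factor is a sign \<open>s\<close>,
      so scaling \<open>A\<close> by it keeps the entries integral.\<close>
    have "\<alpha> * v j = (\<Sum>i<k. of_int (s * A j i) * v i)" if "j < k" for j
    proof -
      have "\<alpha> * v j = \<mu> * (\<alpha> * w j)"
        using s by (simp add: w_def y v_def flip: of_int_mult)
      then show ?thesis by (simp add: Av[OF that, symmetric] s(1) sum_distrib_left mult.assoc)
    qed
    then obtain p :: "int poly" where p: "lead_coeff p = 1" "degree p = k"
        "poly (map_poly of_int p) \<alpha> = 0"
      using j0 root_of_monic_int_poly[of "{..<k}" j0 v \<alpha> "\<lambda>j i. s * A j i"] by auto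
    \<comment> \<open>For \<open>k = 1\<close> the right side is 0, while \<open>p\<close> has
      degree 1.\<close>
    have "k \<le> k * (k - 1)" if "k \<ge> 2" using that by simp
    then show ?thesis using algebraic_int_and_degree_le[OF p(1,3)] unfolding p(2) by (meson le_trans)
  qed
qed

end
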